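(* Let $M$ be a 7-dimensional manifold with a $G_2^*$ structure $\varphi$, let $\xi$ be a vector field on $M$ with $g_{4,3}(\xi,\xi)=-1$, and let $(\phi,\xi,\eta,g)$ be the almost paracontact metric structure induced by $\varphi$ and $\xi$. If $\xi\lrcorner\nabla_\xi\varphi=0$ and $\nabla_\xi\xi=0$, then the component $F^{11}$ of $\nabla\Phi$ vanishes identically.
   Context: $G_2^*$ structures: on $\mathbb{R}^7$ with standard basis $e_1,\dots,e_7$ and dual basis $e^1,\dots,e^7$, let $g_{4,3}$ be the metric of signature $(-,-,-,-,+,+,+)$ for which the basis is orthonormal (the first four vectors having square $-1$), and let $\varphi_0=-e^{127}-e^{135}+e^{146}+e^{236}+e^{245}-e^{347}+e^{567}$, where $e^{ijk}=e^i\wedge e^j\wedge e^k$. $G_2^*$ is the stabilizer of $\varphi_0$ in $GL(7,\mathbb{R})$; it preserves $g_{4,3}$. A $G_2^*$ structure on a smooth oriented 7-manifold $M$ is a smooth 3-form $\varphi$ such that $(T_pM,\varphi_p)$ is isomorphic to $(\mathbb{R}^7,\varphi_0)$ for every $p\in M$. It induces a semi-Riemannian metric, also denoted $g_{4,3}$ (transported pointwise through these isomorphisms), and a cross product $P$ defined by $\varphi(X,Y,Z)=g_{4,3}(P(X,Y),Z)$. Induced almost paracontact metric structure: given a vector field $\xi$ with $g_{4,3}(\xi,\xi)=-1$, set $\phi(X)=P(\xi,X)$, $g=-g_{4,3}$, $\eta(X)=g(\xi,X)$. Then $\phi^2=I-\eta\otimes\xi$, $\eta(\xi)=1$, $g(\phi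 X,\phi Y)=-g(X,Y)+\eta(X)\eta(Y)$. The metrics $g$ and $g_{4,3}$ have the same Levi-Civita connection $\nabla$. The fundamental 2-form is $\Phi(X,Y)=g(\phi X,Y)$ and $F(X,Y,Z)=(\nabla_X\Phi)(Y,Z)$. The component (projection) of $F$ on the class $\mathbb{G}_{11}$ of the classification of almost paracontact metric structures is $$F^{11}(X,Y,Z)=\eta(X)F(\xi,\phi^2Y,\phi^2Z).$$ The condition $\xi\lrcorner\nabla_\xi\varphi=0$ means $(\nabla_\xi\varphi)(\xi,Y,Z)=0$ for all vector fields $Y,Z$. *)

theory Defs
  imports "HOL-Analysis.Analysis"
begin

text \<open>The set \<open>S\<close> is meant to be open: \<open>frechet_derivative f (at x)\<close> is the full, not the
  relative derivative.\<close>

fun C_k_on :: "nat \<Rightarrow> ('a::real_normed_vector \<Rightarrow> 'b::real_normed_vector) \<Rightarrow> 'a set \<Rightarrow> bool" where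
  "C_k_on 0 f S \<longleftrightarrow> continuous_on S f"
| "C_k_on (Suc k) f S \<longleftrightarrow>
     f differentiable_on S \<and> (\<forall>v. C_k_on k (\<lambda>x. frechet_derivative f (at x) v) S)"

definition smooth_on :: "'a::real_normed_vector set \<Rightarrow> ('a \<Rightarrow> 'b::real_normed_vector) \<Rightarrow> bool" where
  "smooth_on S f \<longleftrightarrow> (\<forall>k. C_k_on k f S)"

type_synonym ('m, 'n) chart = "'m set \<times> ('m \<Rightarrow> real ^ 'n)"

abbreviation dom_of :: "('m, 'n) chart \<Rightarrow> 'm set" where "dom_of c \<equiv> fst c"
abbreviation coord :: "('m, 'n) chart \<Rightarrow> 'm \<Rightarrow> real ^ 'n" where "coord c \<equiv> snd c"

definition param :: "('m, 'n) chart \<Rightarrow> real ^ 'n \<Rightarrow> 'm" where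
  "param c = inv_into (dom_of c) (coord c)"

definition is_chart :: "('m::topological_space, 'n::finite) chart \<Rightarrow> bool" where
  "is_chart c \<longleftrightarrow> open (dom_of c) \<and> open (coord c ` dom_of c) \<and>
     homeomorphism (dom_of c) (coord c ` dom_of c) (coord c) (param c)"

definition smooth_atlas :: "('m::topological_space, 'n::finite) chart set \<Rightarrow> bool" where
  "smooth_atlas A \<longleftrightarrow>
     (\<forall>c\<in>A. is_chart c) \<and> (\<Union>c\<in>A. dom_of c) = UNIV \<and>
     (\<forall>c\<in>A. \<forall>d\<in>A. smooth_on (coord c ` (dom_of c \<inter> dom_of d)) (coord d \<circ> param c))"

text \<open>The derivative, at the point with coordinates \<open>coord c p\<close>, of the change of coordinates from
  the chart \<open>c\<close> to the chart \<open>d\<close>.\<close>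

definition transition_deriv ::
    "('m, 'n::finite) chart \<Rightarrow> ('m, 'n) chart \<Rightarrow> 'm \<Rightarrow> real ^ 'n \<Rightarrow> real ^ 'n" where
  "transition_deriv c d p = frechet_derivative (coord d \<circ> param c) (at (coord c p))"

definition oriented_smooth_atlas :: "('m::topological_space, 'n::finite) chart set \<Rightarrow> bool" where
  "oriented_smooth_atlas A \<longleftrightarrow> smooth_atlas A \<and>
     (\<forall>c\<in>A. \<forall>d\<in>A. \<forall>p \<in> dom_of c \<inter> dom_of d. det (matrix (transition_deriv c d p)) > 0)"

text \<open>A tangent vector at \<open>p\<close> is the family of its coordinate vectors in all charts of the atlas
  around \<open>p\<close>, transforming by the derivatives of the coordinate changes. It is set to \<open>0\<close> on all
  other charts, so that equality of tangent vectors is equality of functions; addition and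
  scalar multiplication are chartwise.\<close>

type_synonym ('m, 'n) tvec = "('m, 'n) chart \<Rightarrow> real ^ 'n"
type_synonym ('m, 'n) vfield = "'m \<Rightarrow> ('m, 'n) tvec"

definition tangent_space :: "('m, 'n::finite) chart set \<Rightarrow> 'm \<Rightarrow> ('m, 'n) tvec set" where
  "tangent_space A p = {v.
     (\<forall>c\<in>A. \<forall>d\<in>A. p \<in> dom_of c \<inter> dom_of d \<longrightarrow> v d = transition_deriv c d p (v c)) \<and>
     (\<forall>c. \<not> (c \<in> A \<and> p \<in> dom_of c) \<longrightarrow> v c = 0)}"

definition tv_add :: "('m, 'n::finite) tvec \<Rightarrow> ('m, 'n) tvec \<Rightarrow> ('m, 'n) tvec" where
  "tv_add u v = (\<lambda>c. u c + v c)"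

definition tv_scale :: "real \<Rightarrow> ('m, 'n::finite) tvec \<Rightarrow> ('m, 'n) tvec" where
  "tv_scale r v = (\<lambda>c. r *\<^sub>R v c)"

definition tv_zero :: "('m, 'n::finite) tvec" where
  "tv_zero = (\<lambda>c. 0)"

text \<open>The tangent vector at \<open>p\<close> whose coordinate vector in the chart \<open>c\<close> is \<open>a\<close>, so that
  \<open>coord_tv A c p (axis i 1)\<close> is the \<open>i\<close>-th coordinate vector of \<open>c\<close> at \<open>p\<close>.\<close>

definition coord_tv ::
    "('m, 'n::finite) chart set \<Rightarrow> ('m, 'n) chart \<Rightarrow> 'm \<Rightarrow> real ^ 'n \<Rightarrow> ('m, 'n) tvec" where
  "coord_tv A c p a = (\<lambda>d. if d \<in> A \<and> p \<in> dom_of d then transition_deriv c d p a else 0)"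

definition smooth_function :: "('m, 'n::finite) chart set \<Rightarrow> ('m \<Rightarrow> real) \<Rightarrow> bool" where
  "smooth_function A f \<longleftrightarrow> (\<forall>c\<in>A. smooth_on (coord c ` dom_of c) (f \<circ> param c))"

definition smooth_vfield :: "('m, 'n::finite) chart set \<Rightarrow> ('m, 'n) vfield \<Rightarrow> bool" where
  "smooth_vfield A X \<longleftrightarrow>
     (\<forall>p. X p \<in> tangent_space A p) \<and>
     (\<forall>c\<in>A. smooth_on (coord c ` dom_of c) (\<lambda>x. X (param c x) c))"

definition vf_add :: "('m, 'n::finite) vfield \<Rightarrow> ('m, 'n) vfield \<Rightarrow> ('m, 'n) vfield" where
  "vf_add X Y = (\<lambda>p. tv_add (X p) (Y p))"

definition vf_scale :: "('m \<Rightarrow> real) \<Rightarrow> ('m, 'n::finite) vfield \<Rightarrow> ('m, 'n) vfield" where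
  "vf_scale f X = (\<lambda>p. tv_scale (f p) (X p))"

text \<open>The derivative \<open>X f\<close> of a function along a vector field. For differentiable \<open>f\<close> the value
  does not depend on the chart chosen around \<open>p\<close>, by the chain rule.\<close>

definition dir_deriv ::
    "('m, 'n::finite) chart set \<Rightarrow> ('m, 'n) vfield \<Rightarrow> ('m \<Rightarrow> real) \<Rightarrow> 'm \<Rightarrow> real" where
  "dir_deriv A X f p =
     (let c = (SOME c. c \<in> A \<and> p \<in> dom_of c)
      in frechet_derivative (f \<circ> param c) (at (coord c p)) (X p c))"

definition lie_bracket ::
    "('m, 'n::finite) chart set \<Rightarrow> ('m, 'n) vfield \<Rightarrow> ('m, 'n) vfield \<Rightarrow> ('m, 'n) vfield" where
  "lie_bracket A X Y p c =
     (if c \<in> A \<and> p \<in> dom_of c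
      then frechet_derivative (\<lambda>x. Y (param c x) c) (at (coord c p)) (X p c)
         - frechet_derivative (\<lambda>x. X (param c x) c) (at (coord c p)) (Y p c)
      else 0)"

type_synonym ('m, 'n) two_tensor = "'m \<Rightarrow> ('m, 'n) tvec \<Rightarrow> ('m, 'n) tvec \<Rightarrow> real"
type_synonym ('m, 'n) three_tensor =
  "'m \<Rightarrow> ('m, 'n) tvec \<Rightarrow> ('m, 'n) tvec \<Rightarrow> ('m, 'n) tvec \<Rightarrow> real"

text \<open>Linearity in the first argument and the two sign rules give linearity in all arguments.\<close>

definition smooth_3form :: "('m, 'n::finite) chart set \<Rightarrow> ('m, 'n) three_tensor \<Rightarrow> bool" where
  "smooth_3form A \<phi> \<longleftrightarrow>
     (\<forall>p. \<forall>u \<in> tangent_space A p. \<forall>v \<in> tangent_space A p. \<forall>w \<in> tangent_space A p.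
        (\<forall>u' \<in> tangent_space A p. \<phi> p (tv_add u u') v w = \<phi> p u v w + \<phi> p u' v w) \<and>
        (\<forall>r. \<phi> p (tv_scale r u) v w = r * \<phi> p u v w) \<and>
        \<phi> p v u w = - \<phi> p u v w \<and> \<phi> p u w v = - \<phi> p u v w) \<and>
     (\<forall>c\<in>A. \<forall>i j k. smooth_on (coord c ` dom_of c)
        (\<lambda>x. \<phi> (param c x) (coord_tv A c (param c x) (axis i 1))
               (coord_tv A c (param c x) (axis j 1)) (coord_tv A c (param c x) (axis k 1))))"

text \<open>Connections act on globally defined smooth vector fields; their values on other arguments
  are irrelevant.\<close>

type_synonym ('m, 'n) conn = "('m, 'n) vfield \<Rightarrow> ('m, 'n) vfield \<Rightarrow> ('m, 'n) vfield"

definition affine_connection :: "('m, 'n::finite) chart set \<Rightarrow> ('m, 'n) conn \<Rightarrow> bool" where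
  "affine_connection A nabla \<longleftrightarrow>
     (\<forall>X Y. smooth_vfield A X \<longrightarrow> smooth_vfield A Y \<longrightarrow> smooth_vfield A (nabla X Y)) \<and>
     (\<forall>X X' Y. smooth_vfield A X \<longrightarrow> smooth_vfield A X' \<longrightarrow> smooth_vfield A Y \<longrightarrow>
        nabla (vf_add X X') Y = vf_add (nabla X Y) (nabla X' Y)) \<and>
     (\<forall>f X Y. smooth_function A f \<longrightarrow> smooth_vfield A X \<longrightarrow> smooth_vfield A Y \<longrightarrow>
        nabla (vf_scale f X) Y = vf_scale f (nabla X Y)) \<and>
     (\<forall>X Y Y'. smooth_vfield A X \<longrightarrow> smooth_vfield A Y \<longrightarrow> smooth_vfield A Y' \<longrightarrow>
        nabla X (vf_add Y Y') = vf_add (nabla X Y) (nabla X Y')) \<and>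
     (\<forall>f X Y. smooth_function A f \<longrightarrow> smooth_vfield A X \<longrightarrow> smooth_vfield A Y \<longrightarrow>
        nabla X (vf_scale f Y) = vf_add (vf_scale (dir_deriv A X f) Y) (vf_scale f (nabla X Y)))"

definition levi_civita ::
    "('m, 'n::finite) chart set \<Rightarrow> ('m, 'n) two_tensor \<Rightarrow> ('m, 'n) conn \<Rightarrow> bool" where
  "levi_civita A h nabla \<longleftrightarrow> affine_connection A nabla \<and>
     (\<forall>X Y. smooth_vfield A X \<longrightarrow> smooth_vfield A Y \<longrightarrow>
        nabla X Y = vf_add (nabla Y X) (lie_bracket A X Y)) \<and>
     (\<forall>X Y Z p. smooth_vfield A X \<longrightarrow> smooth_vfield A Y \<longrightarrow> smooth_vfield A Z \<longrightarrow>
        dir_deriv A X (\<lambda>q. h q (Y q) (Z q)) p = h p (nabla X Y p) (Z p) + h p (Y p) (nabla X Z p))"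

text \<open>\<open>cov_deriv2 A nabla T X Y Z p\<close> is the value at \<open>p\<close> of the function
  \<open>(nabla_X T)(Y, Z)\<close>, and similarly for 3-tensors.\<close>

definition cov_deriv2 ::
    "('m, 'n::finite) chart set \<Rightarrow> ('m, 'n) conn \<Rightarrow> ('m, 'n) two_tensor \<Rightarrow>
     ('m, 'n) vfield \<Rightarrow> ('m, 'n) vfield \<Rightarrow> ('m, 'n) vfield \<Rightarrow> 'm \<Rightarrow> real" where
  "cov_deriv2 A nabla T X Y Z p =
     dir_deriv A X (\<lambda>q. T q (Y q) (Z q)) p
     - T p (nabla X Y p) (Z p) - T p (Y p) (nabla X Z p)"

definition cov_deriv3 ::
    "('m, 'n::finite) chart set \<Rightarrow> ('m, 'n) conn \<Rightarrow> ('m, 'n) three_tensor \<Rightarrow>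
     ('m, 'n) vfield \<Rightarrow> ('m, 'n) vfield \<Rightarrow> ('m, 'n) vfield \<Rightarrow> ('m, 'n) vfield \<Rightarrow> 'm \<Rightarrow> real" where
  "cov_deriv3 A nabla T X W Y Z p =
     dir_deriv A X (\<lambda>q. T q (W q) (Y q) (Z q)) p
     - T p (nabla X W p) (Y p) (Z p) - T p (W p) (nabla X Y p) (Z p) - T p (W p) (Y p) (nabla X Z p)"

definition wedge3 :: "7 \<Rightarrow> 7 \<Rightarrow> 7 \<Rightarrow> real ^ 7 \<Rightarrow> real ^ 7 \<Rightarrow> real ^ 7 \<Rightarrow> real" where
  "wedge3 i j k x y z = det (vector
     [vector [x $ i, x $ j, x $ k], vector [y $ i, y $ j, y $ k], vector [z $ i, z $ j, z $ k]]
     :: real ^ 3 ^ 3)"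

definition phi0 :: "real ^ 7 \<Rightarrow> real ^ 7 \<Rightarrow> real ^ 7 \<Rightarrow> real" where
  "phi0 x y z = - wedge3 1 2 7 x y z - wedge3 1 3 5 x y z + wedge3 1 4 6 x y z
     + wedge3 2 3 6 x y z + wedge3 2 4 5 x y z - wedge3 3 4 7 x y z + wedge3 5 6 7 x y z"

definition g0 :: "real ^ 7 \<Rightarrow> real ^ 7 \<Rightarrow> real" where
  "g0 x y = - x $ 1 * y $ 1 - x $ 2 * y $ 2 - x $ 3 * y $ 3 - x $ 4 * y $ 4
     + x $ 5 * y $ 5 + x $ 6 * y $ 6 + x $ 7 * y $ 7"

definition g2s_frame ::
    "('m, 7) chart set \<Rightarrow> ('m, 7) three_tensor \<Rightarrow> 'm \<Rightarrow> (real ^ 7 \<Rightarrow> ('m, 7) tvec) \<Rightarrow> bool" where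
  "g2s_frame A \<phi> p L \<longleftrightarrow>
     bij_betw L UNIV (tangent_space A p) \<and> (\<forall>c. linear (\<lambda>x. L x c)) \<and>
     (\<forall>x y z. \<phi> p (L x) (L y) (L z) = phi0 x y z)"

definition g2s_structure :: "('m, 7) chart set \<Rightarrow> ('m, 7) three_tensor \<Rightarrow> bool" where
  "g2s_structure A \<phi> \<longleftrightarrow> smooth_3form A \<phi> \<and> (\<forall>p. \<exists>L. g2s_frame A \<phi> p L)"

text \<open>Two frames differ by an element of the stabilizer of \<open>phi0\<close>, which preserves \<open>g0\<close>; hence the
  transported metric does not depend on the chosen frame.\<close>

definition g43 :: "('m, 7) chart set \<Rightarrow> ('m, 7) three_tensor \<Rightarrow> ('m, 7) two_tensor" where
  "g43 A \<phi> p u v = (let L = (SOME L. g2s_frame A \<phi> p L) in g0 (inv L u) (inv L v))"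

definition cross ::
    "('m, 7) chart set \<Rightarrow> ('m, 7) three_tensor \<Rightarrow> 'm \<Rightarrow> ('m, 7) tvec \<Rightarrow> ('m, 7) tvec \<Rightarrow> ('m, 7) tvec"
  where
  "cross A \<phi> p u v = (THE w. w \<in> tangent_space A p \<and>
     (\<forall>z \<in> tangent_space A p. \<phi> p u v z = g43 A \<phi> p w z))"

definition para_endo ::
    "('m, 7) chart set \<Rightarrow> ('m, 7) three_tensor \<Rightarrow> ('m, 7) vfield \<Rightarrow> 'm \<Rightarrow> ('m, 7) tvec \<Rightarrow> ('m, 7) tvec"
  where
  "para_endo A \<phi> \<xi> p u = cross A \<phi> p (\<xi> p) u"

definition para_metric :: "('m, 7) chart set \<Rightarrow> ('m, 7) three_tensor \<Rightarrow> ('m, 7) two_tensor" where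
  "para_metric A \<phi> p u v = - g43 A \<phi> p u v"

definition para_eta ::
    "('m, 7) chart set \<Rightarrow> ('m, 7) three_tensor \<Rightarrow> ('m, 7) vfield \<Rightarrow> 'm \<Rightarrow> ('m, 7) tvec \<Rightarrow> real" where
  "para_eta A \<phi> \<xi> p u = para_metric A \<phi> p (\<xi> p) u"

definition fundamental_2form ::
    "('m, 7) chart set \<Rightarrow> ('m, 7) three_tensor \<Rightarrow> ('m, 7) vfield \<Rightarrow> ('m, 7) two_tensor" where
  "fundamental_2form A \<phi> \<xi> p u v = para_metric A \<phi> p (para_endo A \<phi> \<xi> p u) v"

definition tensor_F ::
    "('m, 7) chart set \<Rightarrow> ('m, 7) three_tensor \<Rightarrow> ('m, 7) vfield \<Rightarrow> ('m, 7) conn \<Rightarrow>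
     ('m, 7) vfield \<Rightarrow> ('m, 7) vfield \<Rightarrow> ('m, 7) vfield \<Rightarrow> 'm \<Rightarrow> real" where
  "tensor_F A \<phi> \<xi> nabla = cov_deriv2 A nabla (fundamental_2form A \<phi> \<xi>)"

definition F11 ::
    "('m, 7) chart set \<Rightarrow> ('m, 7) three_tensor \<Rightarrow> ('m, 7) vfield \<Rightarrow> ('m, 7) conn \<Rightarrow>
     ('m, 7) vfield \<Rightarrow> ('m, 7) vfield \<Rightarrow> ('m, 7) vfield \<Rightarrow> 'm \<Rightarrow> real" where
  "F11 A \<phi> \<xi> nabla X Y Z p =
     para_eta A \<phi> \<xi> p (X p) *
     tensor_F A \<phi> \<xi> nabla \<xi>
       (\<lambda>q. para_endo A \<phi> \<xi> q (para_endo A \<phi> \<xi> q (Y q)))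
       (\<lambda>q. para_endo A \<phi> \<xi> q (para_endo A \<phi> \<xi> q (Z q))) p"

end

theory Submission
  imports Defs
begin

text \<open>On tangent vectors the fundamental form is \<open>\<Phi>(u, v) = - \<phi>(\<xi>, u, v)\<close>, so \<open>\<nabla>\<xi>\<xi> = 0\<close> gives
  \<open>F(\<xi>, U, V) = - (\<nabla>\<xi> \<phi>)(\<xi>, U, V) = 0\<close> for all smooth \<open>U\<close>, \<open>V\<close>. The only difficulty is that this must be
  applied to the fields \<open>P(\<xi>, P(\<xi>, Y)) = Y + g\<^sub>4\<^sub>3(\<xi>, Y) \<xi>\<close>, whose smoothness is not evident: the metric is only
  defined pointwise, through frames that need not depend smoothly on the point.

  The function \<open>g\<^sub>4\<^sub>3(\<xi>, Y)\<close> is smooth because it is rational in the components of \<open>\<phi>\<close>, \<open>\<xi>\<close> and \<open>Y\<close>.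
  Let \<open>M\<^sub>u\<close> be the matrix of the 2-form \<open>\<phi>(u, -, -)\<close> and \<open>a\<close> a covector with \<open>a(\<xi>) = 1\<close>. Up to a factor
  independent of \<open>u\<close>, \<open>det (M\<^sub>u + a a\<^sup>T)\<close> is \<open>g\<^sub>4\<^sub>3(u, u)\<^sup>2 a(u)\<^sup>2\<close>; its logarithmic derivative at \<open>u = \<xi>\<close> in
  direction \<open>Y\<close> suggests
  \<open>tr ((M\<^sub>\<xi> + a a\<^sup>T)\<^sup>-\<^sup>1 M\<^sub>Y) = 2 a(Y) - 4 g\<^sub>4\<^sub>3(\<xi>, Y)\<close>,
  which is verified in the model space.\<close>

section \<open>Calculus of smooth functions\<close>

lemma C_k_on_has_derivative:
  assumes "C_k_on (Suc k) f S" "open S" "x \<in> S"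
  shows "(f has_derivative frechet_derivative f (at x)) (at x)"
  using assms by (simp add: differentiable_on_eq_differentiable_at frechet_derivative_works[symmetric])

text \<open>On an open set the full derivative at a point depends only on the values in the set, so
  \<open>f\<close> and \<open>g\<close> share all derivatives there.\<close>

lemma C_k_on_cong:
  assumes "open S" "C_k_on k f S" "\<And>x. x \<in> S \<Longrightarrow> f x = g x"
  shows "C_k_on k g S"
  using assms(2,3)
proof (induction k arbitrary: f g)
  case 0
  then show ?case by (metis C_k_on.simps(1) continuous_on_cong)
next
  case (Suc k)
  have deriv: "(g has_derivative frechet_derivative f (at x)) (at x)" if "x \<in> S" for x
    using C_k_on_has_derivative[OF Suc.prems(1) assms(1) that] Suc.prems(2) assms(1) that
    by (blast intro: has_derivative_transform_within_open)
  then have "g differentiable_on S"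
    by (meson differentiable_at_imp_differentiable_on differentiable_def)
  moreover have "C_k_on k (\<lambda>x. frechet_derivative g (at x) v) S" for v
  proof (rule Suc.IH)
    show "C_k_on k (\<lambda>x. frechet_derivative f (at x) v) S"
      using Suc.prems(1) by simp
  qed (metis deriv frechet_derivative_at)
  ultimately show ?case by simp
qed

text \<open>Introduction rule that accepts any explicit derivative \<open>f'\<close> in place of
  \<open>frechet_derivative\<close>; the closure properties below follow from it by induction on
  \<open>k\<close>.\<close>

lemma C_k_on_Suc:
  assumes "open S" "\<And>x. x \<in> S \<Longrightarrow> (f has_derivative f' x) (at x)"
    and "\<And>v. C_k_on k (\<lambda>x. f' x v) S"
  shows "C_k_on (Suc k) f S"
proof -
  have "f differentiable_on S"
    using assms(2) by (meson differentiable_at_imp_differentiable_on differentiable_def)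
  moreover have "C_k_on k (\<lambda>x. frechet_derivative f (at x) v) S" for v
  proof (rule C_k_on_cong[OF assms(1) assms(3)[of v]])
  qed (metis assms(2) frechet_derivative_at)
  ultimately show ?thesis by simp
qed

lemma C_k_on_lower:
  assumes "C_k_on (Suc k) f S"
  shows "C_k_on k f S"
  using assms
proof (induction k arbitrary: f)
  case 0
  then show ?case by (simp add: differentiable_imp_continuous_on)
next
  case (Suc k)
  then show ?case by (metis C_k_on.simps(2))
qed

lemma C_k_on_const:
  assumes "open S" shows "C_k_on k (\<lambda>x. c) S"
proof (induction k arbitrary: c)
  case (Suc k)
  then show ?case
    by (intro C_k_on_Suc[where f'="\<lambda>x v. 0"] assms) auto
qed simp

lemma C_k_on_add:
  assumes "open S" "C_k_on k f S" "C_k_on k g S"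
  shows "C_k_on k (\<lambda>x. f x + g x) S"
  using assms(2,3)
proof (induction k arbitrary: f g)
  case (Suc k)
  show ?case
    by (rule C_k_on_Suc[OF assms(1) has_derivative_add[OF C_k_on_has_derivative C_k_on_has_derivative]])
      (use Suc assms(1) in auto)
qed (auto intro: continuous_intros)

lemma (in bounded_linear) C_k_on_compose:
  assumes "open S" "C_k_on k g S"
  shows "C_k_on k (\<lambda>x. f (g x)) S"
  using assms(2)
proof (induction k arbitrary: g)
  case (Suc k)
  show ?case
    by (rule C_k_on_Suc[OF assms(1) has_derivative[OF C_k_on_has_derivative]])
      (use Suc assms(1) in auto)
qed (auto intro: continuous_on)

lemma (in bounded_bilinear) C_k_on_bilinear:
  assumes "open S" "C_k_on k f S" "C_k_on k g S"
  shows "C_k_on k (\<lambda>x. prod (f x) (g x)) S"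
  using assms(2,3)
proof (induction k arbitrary: f g)
  case (Suc k)
  show ?case
  proof (rule C_k_on_Suc[OF assms(1) FDERIV[OF C_k_on_has_derivative C_k_on_has_derivative]])
    \<comment> \<open>Each summand of the product rule keeps one undifferentiated factor; it has one
      order of differentiability to spare and is lowered to order \<open>k\<close> for the induction
      hypothesis.\<close>
    fix v
    have "C_k_on k f S" "C_k_on k g S"
      using Suc.prems by (auto dest: C_k_on_lower simp del: C_k_on.simps)
    then show "C_k_on k (\<lambda>x. prod (f x) (frechet_derivative g (at x) v)
                 + prod (frechet_derivative f (at x) v) (g x)) S"
      using Suc by (intro C_k_on_add[OF assms(1)]) auto
  qed (use Suc.prems assms(1) in auto)
qed (auto intro: continuous_on)

text \<open>The derivative of \<open>1 / f\<close> is a product of \<open>f'\<close> and two copies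
  of \<open>1 / f\<close>, whose regularity of order \<open>k\<close> is the induction
  hypothesis.\<close>

lemma C_k_on_inverse:
  fixes f :: "'a::real_normed_vector \<Rightarrow> real"
  assumes "open S" "C_k_on k f S" "\<And>x. x \<in> S \<Longrightarrow> f x \<noteq> 0"
  shows "C_k_on k (\<lambda>x. inverse (f x)) S"
  using assms(2)
proof (induction k)
  case 0
  then show ?case using assms(3) by (auto intro: continuous_intros)
next
  case (Suc k)
  note mult = bounded_bilinear.C_k_on_bilinear[OF bounded_bilinear_mult assms(1)]
  show ?case
  proof (rule C_k_on_Suc[OF assms(1)])
    fix x assume "x \<in> S"
    show "((\<lambda>x. inverse (f x)) has_derivative
        (\<lambda>v. (- 1) * (inverse (f x) * frechet_derivative f (at x) v * inverse (f x)))) (at x)"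
      using Deriv.has_derivative_inverse[OF assms(3)[OF \<open>x \<in> S\<close>]
          C_k_on_has_derivative[OF Suc.prems assms(1) \<open>x \<in> S\<close>]] by simp
  next
    fix v
    show "C_k_on k (\<lambda>x. (- 1) * (inverse (f x) * frechet_derivative f (at x) v * inverse (f x))) S"
      using Suc C_k_on_lower[OF Suc.prems]
      by (intro mult C_k_on_const[OF assms(1)]) auto
  qed
qed

lemma smooth_on_const: "open S \<Longrightarrow> smooth_on S (\<lambda>x. c)"
  by (simp add: smooth_on_def C_k_on_const)

lemma smooth_on_add:
  "\<lbrakk>open S; smooth_on S f; smooth_on S g\<rbrakk> \<Longrightarrow> smooth_on S (\<lambda>x. f x + g x)"
  by (simp add: smooth_on_def C_k_on_add)

lemma smooth_on_mult:
  fixes f g :: "'a::real_normed_vector \<Rightarrow> real"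
  shows "\<lbrakk>open S; smooth_on S f; smooth_on S g\<rbrakk> \<Longrightarrow> smooth_on S (\<lambda>x. f x * g x)"
  by (simp add: smooth_on_def bounded_bilinear.C_k_on_bilinear[OF bounded_bilinear_mult])

lemma smooth_on_scaleR:
  "\<lbrakk>open S; smooth_on S f; smooth_on S g\<rbrakk> \<Longrightarrow> smooth_on S (\<lambda>x. f x *\<^sub>R g x)"
  by (simp add: smooth_on_def bounded_bilinear.C_k_on_bilinear[OF bounded_bilinear_scaleR])

lemma smooth_on_inner:
  "\<lbrakk>open S; smooth_on S f; smooth_on S g\<rbrakk> \<Longrightarrow> smooth_on S (\<lambda>x. f x \<bullet> g x)"
  by (simp add: smooth_on_def bounded_bilinear.C_k_on_bilinear[OF bounded_bilinear_inner])

lemma smooth_on_divide: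
  fixes f g :: "'a::real_normed_vector \<Rightarrow> real"
  shows "\<lbrakk>open S; smooth_on S f; smooth_on S g; \<And>x. x \<in> S \<Longrightarrow> g x \<noteq> 0\<rbrakk>
    \<Longrightarrow> smooth_on S (\<lambda>x. f x / g x)"
  unfolding divide_inverse
  by (rule smooth_on_mult) (auto simp: smooth_on_def C_k_on_inverse)

lemma smooth_on_diff:
  fixes f g :: "'a::real_normed_vector \<Rightarrow> real"
  shows "\<lbrakk>open S; smooth_on S f; smooth_on S g\<rbrakk> \<Longrightarrow> smooth_on S (\<lambda>x. f x - g x)"
  using smooth_on_add[of S f "\<lambda>x. (- 1) * g x"] smooth_on_mult[of S "\<lambda>x. - 1" g]
  by (simp add: smooth_on_const)

lemma smooth_on_sum:
  "\<lbrakk>open S; \<And>i. i \<in> I \<Longrightarrow> smooth_on S (f i)\<rbrakk> \<Longrightarrow> smooth_on S (\<lambda>x. \<Sum>i\<in>I. f i x)"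
  by (induction I rule: infinite_finite_induct) (auto intro: smooth_on_const smooth_on_add)

lemma smooth_on_prod:
  fixes f :: "'i \<Rightarrow> 'a::real_normed_vector \<Rightarrow> real"
  shows "\<lbrakk>open S; \<And>i. i \<in> I \<Longrightarrow> smooth_on S (f i)\<rbrakk> \<Longrightarrow> smooth_on S (\<lambda>x. \<Prod>i\<in>I. f i x)"
  by (induction I rule: infinite_finite_induct) (auto intro: smooth_on_const smooth_on_mult)

lemma smooth_on_nth:
  "\<lbrakk>open S; smooth_on S f\<rbrakk> \<Longrightarrow> smooth_on S (\<lambda>x. f x $ i)"
  by (simp add: smooth_on_def bounded_linear.C_k_on_compose[OF bounded_linear_vec_nth])

lemma smooth_on_cong:
  "\<lbrakk>open S; smooth_on S f; \<And>x. x \<in> S \<Longrightarrow> f x = g x\<rbrakk> \<Longrightarrow> smooth_on S g"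
  unfolding smooth_on_def by (blast intro: C_k_on_cong)

lemma smooth_on_differentiable:
  assumes "smooth_on S f" "open S" "x \<in> S"
  shows "f differentiable (at x)"
proof -
  have "C_k_on (Suc 0) f S" using assms(1) unfolding smooth_on_def by blast
  then show ?thesis using assms by (simp add: differentiable_on_eq_differentiable_at)
qed

section \<open>Determinants and inverses of matrices with smooth entries\<close>

lemma smooth_on_det:
  fixes f :: "'a::real_normed_vector \<Rightarrow> real ^ 'n ^ 'n"
  assumes "open S" "\<And>i j. smooth_on S (\<lambda>x. f x $ i $ j)"
  shows "smooth_on S (\<lambda>x. det (f x))"
  unfolding det_def
  by (intro smooth_on_sum smooth_on_mult smooth_on_prod smooth_on_const assms)

text \<open>Cramer's rule for the system \<open>N *v u = axis j 1\<close>, solved by the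
  \<open>j\<close>-th column of \<open>R\<close>.\<close>

lemma right_inverse_matrix_nth:
  fixes N R :: "real ^ 'n ^ 'n"
  assumes "N ** R = mat 1"
  shows "R $ k $ j = det (\<chi> i l. if l = k then axis j 1 $ i else N $ i $ l) / det N"
proof -
  have "det N \<noteq> 0"
    using assms by (metis invertible_right_inverse invertible_det_nz)
  moreover have "N *v (R *v axis j 1) = axis j 1"
    using assms by (simp add: matrix_vector_mul_assoc)
  ultimately have "R *v axis j 1 =
      (\<chi> k. det (\<chi> i l. if l = k then axis j 1 $ i else N $ i $ l) / det N)"
    using cramer by blast
  moreover have "R $ k $ j = (R *v axis j 1) $ k"
    by (simp add: matrix_vector_mult_basis column_def)
  ultimately show ?thesis by simp
qed

text \<open>The inverse \<open>R\<close> may be chosen point by point: its entries are forced to be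
  quotients of polynomials in the entries of \<open>f\<close>.\<close>

lemma smooth_on_right_inverse:
  fixes f R :: "'a::real_normed_vector \<Rightarrow> real ^ 'n ^ 'n"
  assumes "open S" "\<And>i j. smooth_on S (\<lambda>x. f x $ i $ j)"
    and inv: "\<And>x. x \<in> S \<Longrightarrow> f x ** R x = mat 1"
  shows "smooth_on S (\<lambda>x. R x $ k $ j)"
proof (rule smooth_on_cong[OF assms(1)])
  have "smooth_on S (\<lambda>x. if l = k then axis j 1 $ i else f x $ i $ l)" for i l
    using assms(1,2) by (cases "l = k") (auto intro: smooth_on_const)
  moreover have "det (f x) \<noteq> 0" if "x \<in> S" for x
    using inv[OF that] by (metis invertible_right_inverse invertible_det_nz)
  ultimately show
    "smooth_on S (\<lambda>x. det (\<chi> i l. if l = k then axis j 1 $ i else f x $ i $ l) / det (f x))"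
    by (intro smooth_on_divide smooth_on_det assms) auto
qed (simp add: right_inverse_matrix_nth[OF inv])

section \<open>Algebra of the model form\<close>

lemma exhaust_7:
  fixes x :: 7
  shows "x = 1 \<or> x = 2 \<or> x = 3 \<or> x = 4 \<or> x = 5 \<or> x = 6 \<or> x = 7"
proof (induct x)
  case (of_int z)
  then have "0 \<le> z" and "z < 7" by simp_all
  then have "z = 0 \<or> z = 1 \<or> z = 2 \<or> z = 3 \<or> z = 4 \<or> z = 5 \<or> z = 6" by arith
  then show ?case by auto
qed

lemma forall_7: "(\<forall>i::7. P i) \<longleftrightarrow> P 1 \<and> P 2 \<and> P 3 \<and> P 4 \<and> P 5 \<and> P 6 \<and> P 7"
  by (metis exhaust_7)

lemma UNIV_7: "UNIV = {1, 2, 3, 4, 5, 6, 7::7}"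
  using exhaust_7 by auto

lemma sum_7: "sum f (UNIV::7 set) = f 1 + f 2 + f 3 + f 4 + f 5 + f 6 + f 7"
  unfolding UNIV_7 by (simp add: ac_simps)

text \<open>\<open>flip0\<close> is the Gram matrix of \<open>g0\<close>; it is its own inverse.\<close>

definition flip0 :: "real ^ 7 \<Rightarrow> real ^ 7" where
  "flip0 x = (\<chi> i. if i = 5 \<or> i = 6 \<or> i = 7 then x $ i else - x $ i)"

text \<open>The covector \<open>phi0 x y\<close> turned into a vector by \<open>g0\<close>; raising
  the index is again \<open>flip0\<close>, as this is its own inverse.\<close>

definition cross0 :: "real ^ 7 \<Rightarrow> real ^ 7 \<Rightarrow> real ^ 7" where
  "cross0 x y = flip0 (\<chi> i. phi0 x y (axis i 1))"

lemma flip0_nth [simp]: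
  "flip0 x $ 1 = - x $ 1" "flip0 x $ 2 = - x $ 2" "flip0 x $ 3 = - x $ 3" "flip0 x $ 4 = - x $ 4"
  "flip0 x $ 5 = x $ 5" "flip0 x $ 6 = x $ 6" "flip0 x $ 7 = x $ 7"
  by (simp_all add: flip0_def)

lemma flip0_flip0 [simp]: "flip0 (flip0 x) = x"
  by (simp add: vec_eq_iff forall_7)

lemma linear_flip0: "linear flip0"
  by (rule linearI) (simp_all add: vec_eq_iff forall_7)

lemma inner_7: "(x::real ^ 7) \<bullet> y =
  x $ 1 * y $ 1 + x $ 2 * y $ 2 + x $ 3 * y $ 3 + x $ 4 * y $ 4 + x $ 5 * y $ 5 + x $ 6 * y $ 6
  + x $ 7 * y $ 7"
  by (simp add: inner_vec_def sum_7)

lemma g0_eq_inner: "g0 x y = flip0 x \<bullet> y"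
  by (simp add: g0_def inner_7)

lemma phi0_expand: "phi0 x y z =
   - (x$1*(y$2*z$7 - y$7*z$2) - x$2*(y$1*z$7 - y$7*z$1) + x$7*(y$1*z$2 - y$2*z$1))
   - (x$1*(y$3*z$5 - y$5*z$3) - x$3*(y$1*z$5 - y$5*z$1) + x$5*(y$1*z$3 - y$3*z$1))
   + (x$1*(y$4*z$6 - y$6*z$4) - x$4*(y$1*z$6 - y$6*z$1) + x$6*(y$1*z$4 - y$4*z$1))
   + (x$2*(y$3*z$6 - y$6*z$3) - x$3*(y$2*z$6 - y$6*z$2) + x$6*(y$2*z$3 - y$3*z$2))
   + (x$2*(y$4*z$5 - y$5*z$4) - x$4*(y$2*z$5 - y$5*z$2) + x$5*(y$2*z$4 - y$4*z$2))
   - (x$3*(y$4*z$7 - y$7*z$4) - x$4*(y$3*z$7 - y$7*z$3) + x$7*(y$3*z$4 - y$4*z$3))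
   + (x$5*(y$6*z$7 - y$7*z$6) - x$6*(y$5*z$7 - y$7*z$5) + x$7*(y$5*z$6 - y$6*z$5))"
  unfolding phi0_def wedge3_def det_3 vector_3 by (simp add: algebra_simps)

lemma linear_phi0_1: "linear (\<lambda>x. phi0 x y z)"
  by (rule linearI) (simp_all add: phi0_expand algebra_simps)

lemma phi0_swap12: "phi0 y x z = - phi0 x y z"
  by (simp add: phi0_expand algebra_simps)

lemma phi0_swap23: "phi0 x z y = - phi0 x y z"
  by (simp add: phi0_expand algebra_simps)

lemma linear_phi0_2: "linear (\<lambda>y. phi0 x y z)"
  using linear_compose_neg[OF linear_phi0_1[of x z]] by (simp add: phi0_swap12[symmetric])

lemma linear_phi0_3: "linear (\<lambda>z. phi0 x y z)"
  using linear_compose_neg[OF linear_phi0_2[of x y]] by (simp add: phi0_swap23[symmetric])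

lemma cross0_nth:
  "cross0 x y $ 1 = - phi0 x y (axis 1 1)" "cross0 x y $ 2 = - phi0 x y (axis 2 1)"
  "cross0 x y $ 3 = - phi0 x y (axis 3 1)" "cross0 x y $ 4 = - phi0 x y (axis 4 1)"
  "cross0 x y $ 5 = phi0 x y (axis 5 1)" "cross0 x y $ 6 = phi0 x y (axis 6 1)"
  "cross0 x y $ 7 = phi0 x y (axis 7 1)"
  by (simp_all add: cross0_def)

lemma cross0_expand:
  "cross0 x y $ 1 = x$2*y$7 - x$7*y$2 + x$3*y$5 - x$5*y$3 - x$4*y$6 + x$6*y$4"
  "cross0 x y $ 2 = x$7*y$1 - x$1*y$7 - x$3*y$6 + x$6*y$3 - x$4*y$5 + x$5*y$4"
  "cross0 x y $ 3 = x$5*y$1 - x$1*y$5 + x$2*y$6 - x$6*y$2 + x$4*y$7 - x$7*y$4"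
  "cross0 x y $ 4 = x$1*y$6 - x$6*y$1 + x$2*y$5 - x$5*y$2 - x$3*y$7 + x$7*y$3"
  "cross0 x y $ 5 = x$3*y$1 - x$1*y$3 + x$2*y$4 - x$4*y$2 + x$6*y$7 - x$7*y$6"
  "cross0 x y $ 6 = x$1*y$4 - x$4*y$1 + x$2*y$3 - x$3*y$2 - x$5*y$7 + x$7*y$5"
  "cross0 x y $ 7 = x$2*y$1 - x$1*y$2 - x$3*y$4 + x$4*y$3 + x$5*y$6 - x$6*y$5"
  unfolding cross0_nth phi0_expand axis_nth by (simp_all add: axis_def algebra_simps)

lemma phi0_eq_g0_cross0: "phi0 x y z = g0 (cross0 x y) z"
  by (simp add: g0_def cross0_expand phi0_expand algebra_simps)

lemma linear_cross0: "linear (cross0 x)"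
  by (rule linearI) (simp_all add: vec_eq_iff forall_7 cross0_expand algebra_simps)

lemma cross0_commute: "cross0 y x = - cross0 x y"
  by (simp add: vec_eq_iff forall_7 cross0_expand algebra_simps)

text \<open>The characteristic identity of a cross product, checked as a polynomial identity. If
  \<open>g0 x x = - 1\<close>, the square of \<open>cross0 x\<close> is the projection along
  \<open>x\<close> onto its \<open>g0\<close>-orthogonal complement.\<close>

lemma cross0_cross0: "cross0 x (cross0 x y) = g0 x y *\<^sub>R x - g0 x x *\<^sub>R y"
  by (simp add: vec_eq_iff forall_7 cross0_expand g0_def algebra_simps)

text \<open>For \<open>x = y\<close> the trace of \<open>cross0_cross0\<close> is
  \<open>g0 x x - 7 * g0 x x\<close>; the formula is its polarization.\<close>

lemma trace_cross0_cross0: "(\<Sum>i\<in>UNIV. cross0 x (cross0 y (axis i 1)) $ i) = - 6 * g0 x y"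
  by (simp add: sum_7 cross0_expand g0_def axis_def algebra_simps)

text \<open>The first argument is the column index: this is the matrix of the map \<open>u \<mapsto> f u\<close> into covectors.\<close>

definition form_matrix :: "(real ^ 'n \<Rightarrow> real ^ 'n \<Rightarrow> real) \<Rightarrow> real ^ 'n ^ 'n" where
  "form_matrix f = (\<chi> i j. f (axis j 1) (axis i 1))"

section \<open>Matrices of bilinear forms and the trace formula\<close>

lemma form_matrix_mult_vec:
  assumes "\<And>v. linear (\<lambda>u. f u v)" and "\<And>v u. f u v = h u \<bullet> v"
  shows "form_matrix f *v u = h u"
proof -
  have "(form_matrix f *v u) $ i = h u $ i" for i
  proof -
    have "(form_matrix f *v u) $ i = (\<Sum>j\<in>UNIV. u $ j * f (axis j 1) (axis i 1))"
      by (simp add: form_matrix_def matrix_vector_mult_def mult.commute)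
    also have "\<dots> = f (\<Sum>j\<in>UNIV. u $ j *\<^sub>R axis j 1) (axis i 1)"
      by (simp add: linear_sum[OF assms(1)] linear_scale[OF assms(1)])
    also have "\<dots> = h u $ i"
      using basis_expansion[of u] assms(2) by (simp add: inner_axis scalar_mult_eq_scaleR)
    finally show ?thesis .
  qed
  then show ?thesis by (simp add: vec_eq_iff)
qed

text \<open>Change of basis for a bilinear form, used to pass between chart coordinates and the
  model.\<close>

lemma form_matrix_compose:
  fixes B :: "real ^ 'n ^ 'n"
  assumes "\<And>v. linear (\<lambda>u. f u v)" and "\<And>v u. f u v = h u \<bullet> v"
  shows "form_matrix (\<lambda>u v. f (B *v u) (B *v v)) = transpose B ** form_matrix f ** B"
proof -
  have "form_matrix (\<lambda>u v. f (B *v u) (B *v v)) *v u = (transpose B ** form_matrix f ** B) *v u" for u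
  proof -
    have "form_matrix (\<lambda>u v. f (B *v u) (B *v v)) *v u = transpose B *v h (B *v u)"
    proof (rule form_matrix_mult_vec)
      show "linear (\<lambda>u. f (B *v u) (B *v v))" for v
        using linear_compose[OF matrix_vector_mul_linear[of B] assms(1)] by (simp add: o_def)
      show "f (B *v u) (B *v v) = (transpose B *v h (B *v u)) \<bullet> v" for u v
        by (simp add: assms(2) dot_lmul_matrix)
    qed
    also have "\<dots> = (transpose B ** form_matrix f ** B) *v u"
      using form_matrix_mult_vec[OF assms] by (simp add: matrix_vector_mul_assoc[symmetric])
    finally show ?thesis .
  qed
  then show ?thesis by (simp add: matrix_eq)
qed

lemma phi0_eq_inner: "phi0 x u v = flip0 (cross0 x u) \<bullet> v"
  by (simp add: phi0_eq_g0_cross0 g0_eq_inner)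

text \<open>Contraction with \<open>x\<close> has kernel spanned by \<open>x\<close>; adding the square of a covector \<open>a\<close> with
  \<open>a x = 1\<close> makes it invertible. On the annihilator of \<open>x\<close> the inverse is \<open>cross0 x \<circ> flip0\<close>, because
  \<open>cross0 x\<close> squares to the projection along \<open>x\<close>.\<close>

lemma model_trace_formula:
  assumes q: "g0 x x = - 1" and a: "a \<bullet> x = 1"
  defines "N \<equiv> form_matrix (\<lambda>u v. phi0 x u v + (a \<bullet> u) * (a \<bullet> v))"
  shows "\<exists>R. N ** R = mat 1 \<and>
    (\<forall>y. trace (R ** form_matrix (phi0 y)) = 2 * (a \<bullet> y) - 4 * g0 x y)"
proof -
  define S where "S v = cross0 x (flip0 v)" for v
  \<comment> \<open>The inverse of \<open>N\<close>. The covector \<open>v\<close> splits into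
    \<open>v - (x \<bullet> v) *\<^sub>R a\<close>, which annihilates \<open>x\<close>, and a
    multiple of \<open>a\<close>. The first part is inverted by \<open>S\<close>, corrected by a
    multiple of \<open>x\<close> so that \<open>a\<close> vanishes on the result; the second goes to
    a multiple of \<open>x\<close>, since \<open>N *v x = a\<close>.\<close>
  define r where "r v = S (v - (x \<bullet> v) *\<^sub>R a) - (a \<bullet> S (v - (x \<bullet> v) *\<^sub>R a)) *\<^sub>R x + (x \<bullet> v) *\<^sub>R x" for v
  have linS: "linear S"
    unfolding S_def using linear_compose[OF linear_flip0 linear_cross0] by (simp add: o_def)
  \<comment> \<open>\<open>u \<bullet> S v\<close> is \<open>phi0 x (flip0 v) (flip0 u)\<close>,
    hence alternating in \<open>u\<close> and \<open>v\<close>.\<close>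
  have S_skew: "u \<bullet> S v = - (v \<bullet> S u)" for u v
    by (simp add: S_def inner_7 cross0_expand algebra_simps)
  have S_self: "u \<bullet> S u = 0" for u
    using S_skew[of u u] by simp
  have r_eq: "r v = S v - (x \<bullet> v) *\<^sub>R S a - (a \<bullet> S v) *\<^sub>R x + (x \<bullet> v) *\<^sub>R x" for v
    by (simp add: r_def linear_diff[OF linS] linear_scale[OF linS] inner_diff_right S_self)
  have linr: "linear r"
    by (rule linearI) (simp_all add: r_eq linear_add[OF linS] linear_scale[OF linS] algebra_simps inner_add_right)
  have Nv: "N *v u = flip0 (cross0 x u) + (a \<bullet> u) *\<^sub>R a" for u
    unfolding N_def
  proof (rule form_matrix_mult_vec)
    show "linear (\<lambda>u. phi0 x u v + (a \<bullet> u) * (a \<bullet> v))" for v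
      by (rule linearI)
        (simp_all add: linear_add[OF linear_phi0_2] linear_scale[OF linear_phi0_2] inner_add_right algebra_simps)
    show "phi0 x u v + (a \<bullet> u) * (a \<bullet> v) = (flip0 (cross0 x u) + (a \<bullet> u) *\<^sub>R a) \<bullet> v" for u v
      by (simp add: phi0_eq_inner inner_add_left)
  qed
  have cross_self: "cross0 x x = 0"
    using cross0_commute[of x x] by (simp add: vec_eq_iff)
  have flipS: "flip0 (cross0 x (S v)) = v + (x \<bullet> v) *\<^sub>R flip0 x" for v
  proof -
    have "g0 x (flip0 v) = x \<bullet> v" by (simp add: g0_def inner_7)
    then show ?thesis
      by (simp add: S_def cross0_cross0 q linear_add[OF linear_flip0] linear_scale[OF linear_flip0])
  qed
  have "N *v r v = v" for v
  proof -
    define u where "u = v - (x \<bullet> v) *\<^sub>R a"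
    have "x \<bullet> u = 0" using a by (simp add: u_def inner_diff_right inner_commute)
    then have "flip0 (cross0 x (r v)) = u"
      using flipS[of u] cross_self
      by (simp add: r_def u_def[symmetric] linear_diff[OF linear_cross0] linear_add[OF linear_cross0]
          linear_scale[OF linear_cross0] linear_diff[OF linear_flip0] linear_add[OF linear_flip0]
          linear_scale[OF linear_flip0])
    moreover have "a \<bullet> r v = x \<bullet> v"
      using a by (simp add: r_def inner_add_right inner_diff_right)
    ultimately show ?thesis by (simp add: Nv u_def)
  qed
  then have "N ** matrix r = mat 1"
    by (simp add: matrix_eq matrix_vector_mul_assoc[symmetric] matrix_works[OF linr[folded linear_matrix_vector_mul_eq]])
  moreover have "trace (matrix r ** form_matrix (phi0 y)) = 2 * (a \<bullet> y) - 4 * g0 x y" for y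
  proof -
    define m where "m u = flip0 (cross0 y u)" for u
    have My: "form_matrix (phi0 y) *v u = m u" for u
      unfolding m_def by (intro form_matrix_mult_vec linear_phi0_2 phi0_eq_inner)
    have m_skew: "u \<bullet> m v = - (v \<bullet> m u)" for u v
      unfolding m_def by (metis inner_commute phi0_eq_inner phi0_swap23)
    have "trace (matrix r ** form_matrix (phi0 y)) = (\<Sum>i\<in>UNIV. r (m (axis i 1)) $ i)"
    proof -
      have "(matrix r ** form_matrix (phi0 y)) $ i $ i = r (m (axis i 1)) $ i" for i
      proof -
        have "(matrix r ** form_matrix (phi0 y)) $ i $ i
          = ((matrix r ** form_matrix (phi0 y)) *v axis i 1) $ i"
          by (simp add: matrix_vector_mult_basis column_def)
        then show ?thesis
          by (simp add: matrix_vector_mul_assoc[symmetric] matrix_works[OF linr[folded linear_matrix_vector_mul_eq]] My)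
      qed
      then show ?thesis by (simp add: trace_def)
    qed
    \<comment> \<open>Skewness of \<open>m\<close> and \<open>S\<close> moves the basis vector out
      of the rank-one terms of \<open>r\<close>, so that their traces become inner products.\<close>
    also have "\<dots> = (\<Sum>i\<in>UNIV. S (m (axis i 1)) $ i) + (\<Sum>i\<in>UNIV. m x $ i * S a $ i)
        + (\<Sum>i\<in>UNIV. m (S a) $ i * (- x $ i)) - (\<Sum>i\<in>UNIV. m x $ i * x $ i)"
    proof -
      have "x \<bullet> m (axis i 1) = - m x $ i" for i
        using m_skew[of x "axis i 1"] by (simp add: inner_axis')
      moreover have "a \<bullet> S (m (axis i 1)) = m (S a) $ i" for i
        using S_skew[of a "m (axis i 1)"] m_skew[of "axis i 1" "S a"]
        by (simp add: inner_axis' inner_commute)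
      ultimately show ?thesis
        by (simp add: r_eq sum.distrib sum_subtractf sum_negf)
    qed
    also have "\<dots> = - 6 * g0 x y + m x \<bullet> S a - m (S a) \<bullet> x - m x \<bullet> x"
      using trace_cross0_cross0[of x y]
      by (simp add: S_def m_def inner_vec_def sum_negf)
    also have "\<dots> = - 6 * g0 x y + 2 * (m x \<bullet> S a)"
      using m_skew[of x x] m_skew[of x "S a"] by (simp add: inner_commute)
    also have "m x \<bullet> S a = a \<bullet> y + g0 x y"
    proof -
      have "m x \<bullet> S a = - (a \<bullet> cross0 x (cross0 y x))"
        using S_skew[of "m x" a] by (simp add: S_def m_def)
      also have "\<dots> = a \<bullet> cross0 x (cross0 x y)"
        by (subst cross0_commute[of y x]) (simp add: linear_neg[OF linear_cross0])
      also have "\<dots> = a \<bullet> y + g0 x y"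
        by (simp add: cross0_cross0 q inner_add_right a)
      finally show ?thesis .
    qed
    finally show ?thesis by simp
  qed
  ultimately show ?thesis by blast
qed

text \<open>The model formula transported by \<open>B\<close>: form matrices change by congruence,
  the inverse becomes \<open>Q ** R ** transpose Q\<close>, and cyclicity of the trace cancels
  \<open>B\<close> against \<open>Q\<close>.\<close>

lemma trace_formula:
  fixes B Q :: "real ^ 7 ^ 7"
  assumes BQ: "B ** Q = mat 1" and q: "g0 (B *v x) (B *v x) = - 1" and a: "a \<bullet> x = 1"
  defines "T \<equiv> \<lambda>u v w. phi0 (B *v u) (B *v v) (B *v w)"
  shows "\<exists>R. form_matrix (\<lambda>u v. T x u v + (a \<bullet> u) * (a \<bullet> v)) ** R = mat 1 \<and>
    (\<forall>y. trace (R ** form_matrix (T y)) = 2 * (a \<bullet> y) - 4 * g0 (B *v x) (B *v y))"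
proof -
  \<comment> \<open>The covector \<open>a\<close> expressed in model coordinates: \<open>a0\<close>
    on \<open>B *v v\<close> equals \<open>a\<close> on \<open>v\<close>.\<close>
  define a0 where "a0 = transpose Q *v a"
  have QB: "Q ** B = mat 1" using BQ by (rule matrix_left_right_inverse[THEN iffD1])
  have a0: "a0 \<bullet> (B *v v) = a \<bullet> v" for v
    by (simp add: a0_def dot_lmul_matrix matrix_vector_mul_assoc QB)
  define f0 where "f0 u v = phi0 (B *v x) u v + (a0 \<bullet> u) * (a0 \<bullet> v)" for u v
  obtain R where R: "form_matrix f0 ** R = mat 1"
      "\<And>y. trace (R ** form_matrix (phi0 y)) = 2 * (a0 \<bullet> y) - 4 * g0 (B *v x) y"
    using model_trace_formula[OF q, of a0] a a0 unfolding f0_def by auto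
  have "form_matrix (\<lambda>u v. T x u v + (a \<bullet> u) * (a \<bullet> v))
      = form_matrix (\<lambda>u v. f0 (B *v u) (B *v v))"
    by (simp add: T_def f0_def a0)
  also have "\<dots> = transpose B ** form_matrix f0 ** B"
  proof (rule form_matrix_compose)
    show "linear (\<lambda>u. f0 u v)" for v unfolding f0_def
      by (rule linearI)
        (simp_all add: linear_add[OF linear_phi0_2] linear_scale[OF linear_phi0_2] inner_add_right algebra_simps)
    show "f0 u v = (flip0 (cross0 (B *v x) u) + (a0 \<bullet> u) *\<^sub>R a0) \<bullet> v" for u v
      by (simp add: f0_def phi0_eq_inner inner_add_left)
  qed
  finally have N: "form_matrix (\<lambda>u v. T x u v + (a \<bullet> u) * (a \<bullet> v))
      = transpose B ** form_matrix f0 ** B" .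
  have M: "form_matrix (T y) = transpose B ** form_matrix (phi0 (B *v y)) ** B" for y
    unfolding T_def by (rule form_matrix_compose[OF linear_phi0_2 phi0_eq_inner])
  have tr: "transpose B ** transpose Q = mat 1" "transpose Q ** transpose B = mat 1"
    using QB BQ by (simp_all flip: matrix_transpose_mul)
  have "(transpose B ** form_matrix f0 ** B) ** (Q ** R ** transpose Q)
      = transpose B ** ((form_matrix f0 ** ((B ** Q) ** R)) ** transpose Q)"
    by (simp only: matrix_mul_assoc)
  also have "\<dots> = mat 1" by (simp add: BQ R tr)
  finally have 1: "form_matrix (\<lambda>u v. T x u v + (a \<bullet> u) * (a \<bullet> v)) ** (Q ** R ** transpose Q) = mat 1"
    by (simp add: N)
  have 2: "trace ((Q ** R ** transpose Q) ** form_matrix (T y))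
      = 2 * (a \<bullet> y) - 4 * g0 (B *v x) (B *v y)" for y
  proof -
    have "trace ((Q ** R ** transpose Q) ** form_matrix (T y))
        = trace (Q ** (R ** ((transpose Q ** transpose B) ** form_matrix (phi0 (B *v y))) ** B))"
      by (simp only: M matrix_mul_assoc)
    also have "\<dots> = trace ((R ** form_matrix (phi0 (B *v y))) ** (B ** Q))"
      by (subst trace_mul_sym) (simp add: tr matrix_mul_assoc)
    finally show ?thesis by (simp add: BQ R a0)
  qed
  show ?thesis using 1 2 by blast
qed

section \<open>Manifolds with a 3-form of model type\<close>

lemma smooth_atlas_transition:
  assumes "smooth_atlas A" "c \<in> A" "d \<in> A" "p \<in> dom_of c" "p \<in> dom_of d"
  shows linear_transition_deriv: "linear (transition_deriv c d p)"
    and transition_deriv_self: "transition_deriv c c p = id"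
proof -
  have chart: "open (coord c ` dom_of c)" "open (dom_of d)"
    "homeomorphism (dom_of c) (coord c ` dom_of c) (coord c) (param c)"
    using assms by (auto simp: smooth_atlas_def is_chart_def)
  let ?U = "coord c ` (dom_of c \<inter> dom_of d)"
  \<comment> \<open>The image of the overlap is a preimage under the continuous
    \<open>param c\<close>, hence open; smoothness on it then gives true differentiability at
    \<open>coord c p\<close>.\<close>
  have "?U = coord c ` dom_of c \<inter> param c -` dom_of d"
    using chart(3) by (force simp: homeomorphism_def)
  then have "open ?U"
    using chart by (metis continuous_open_preimage homeomorphism_cont2)
  moreover have "smooth_on ?U (coord d \<circ> param c)"
    using assms by (simp add: smooth_atlas_def)
  ultimately have "(coord d \<circ> param c) differentiable (at (coord c p))"
    using assms(4,5) by (intro smooth_on_differentiable) auto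
  then show "linear (transition_deriv c d p)"
    unfolding transition_deriv_def by (rule linear_frechet_derivative)
  have "((coord c \<circ> param c) has_derivative id) (at (coord c p))"
  proof (rule has_derivative_transform_within_open[OF has_derivative_id chart(1)])
    show "coord c p \<in> coord c ` dom_of c" using assms(4) by blast
    show "id y = (coord c \<circ> param c) y" if "y \<in> coord c ` dom_of c" for y
      using chart(3) that by (auto simp: homeomorphism_def)
  qed
  then show "transition_deriv c c p = id"
    unfolding transition_deriv_def by (metis frechet_derivative_at)
qed

lemma trilinear_expand:
  fixes f :: "real ^ 'n \<Rightarrow> real ^ 'n \<Rightarrow> real ^ 'n \<Rightarrow> real"
  assumes "\<And>v w. linear (\<lambda>u. f u v w)" "\<And>u w. linear (\<lambda>v. f u v w)" "\<And>u v. linear (\<lambda>w. f u v w)"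
  shows "f u v w = (\<Sum>i\<in>UNIV. \<Sum>j\<in>UNIV. \<Sum>k\<in>UNIV.
    u $ i * v $ j * w $ k * f (axis i 1) (axis j 1) (axis k 1))"
proof -
  have 1: "f u v w = (\<Sum>i\<in>UNIV. u $ i * f (axis i 1) v w)" for u v w
    using arg_cong[OF basis_expansion[of u], of "\<lambda>u. f u v w"]
    by (simp add: linear_sum[OF assms(1)] linear_scale[OF assms(1)] scalar_mult_eq_scaleR)
  have 2: "f u v w = (\<Sum>j\<in>UNIV. v $ j * f u (axis j 1) w)" for u v w
    using arg_cong[OF basis_expansion[of v], of "\<lambda>v. f u v w"]
    by (simp add: linear_sum[OF assms(2)] linear_scale[OF assms(2)] scalar_mult_eq_scaleR)
  have 3: "f u v w = (\<Sum>k\<in>UNIV. w $ k * f u v (axis k 1))" for u v w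
    using arg_cong[OF basis_expansion[of w], of "f u v"]
    by (simp add: linear_sum[OF assms(3)] linear_scale[OF assms(3)] scalar_mult_eq_scaleR)
  have "f u v w = (\<Sum>i\<in>UNIV. u $ i * (\<Sum>j\<in>UNIV. v $ j *
      (\<Sum>k\<in>UNIV. w $ k * f (axis i 1) (axis j 1) (axis k 1))))"
    by (subst 1, subst 2, subst 3) (rule refl)
  then show ?thesis by (simp add: sum_distrib_left mult.assoc)
qed

section \<open>Pointwise algebra in adapted frames\<close>

locale g2s_manifold =
  fixes A :: "('m::topological_space, 7) chart set" and \<phi> :: "('m, 7) three_tensor"
  assumes atlas: "smooth_atlas A" and g2s: "g2s_structure A \<phi>"
begin

text \<open>The same choice of frame as inside \<open>g43\<close>, so that \<open>g43_eq\<close>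
  holds by unfolding.\<close>

definition frame :: "'m \<Rightarrow> real ^ 7 \<Rightarrow> ('m, 7) tvec" where
  "frame p = (SOME L. g2s_frame A \<phi> p L)"

definition coframe :: "'m \<Rightarrow> ('m, 7) tvec \<Rightarrow> real ^ 7" where
  "coframe p = inv (frame p)"

lemma g2s_frame_frame: "g2s_frame A \<phi> p (frame p)"
  using g2s unfolding g2s_structure_def frame_def by (metis someI_ex)

lemma frame_mem [simp]: "frame p x \<in> tangent_space A p"
  using g2s_frame_frame[of p] unfolding g2s_frame_def bij_betw_def by auto

lemma linear_frame: "linear (\<lambda>x. frame p x c)"
  using g2s_frame_frame[of p] unfolding g2s_frame_def by blast

lemma coframe_frame [simp]: "coframe p (frame p x) = x"
  using g2s_frame_frame[of p] unfolding g2s_frame_def coframe_def bij_betw_def by simp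

lemma frame_coframe [simp]: "u \<in> tangent_space A p \<Longrightarrow> frame p (coframe p u) = u"
  using g2s_frame_frame[of p] unfolding g2s_frame_def coframe_def bij_betw_def
  by (metis f_inv_into_f)

lemma frame_add: "frame p (x + y) = tv_add (frame p x) (frame p y)"
  by (simp add: tv_add_def fun_eq_iff linear_add[OF linear_frame])

lemma frame_scale: "frame p (r *\<^sub>R x) = tv_scale r (frame p x)"
  by (simp add: tv_scale_def fun_eq_iff linear_scale[OF linear_frame])

lemma frame_0: "frame p 0 = tv_zero"
  by (simp add: tv_zero_def fun_eq_iff linear_0[OF linear_frame])

lemma three_form_eq:
  assumes "u \<in> tangent_space A p" "v \<in> tangent_space A p" "w \<in> tangent_space A p"
  shows "\<phi> p u v w = phi0 (coframe p u) (coframe p v) (coframe p w)"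
  using g2s_frame_frame[of p] assms unfolding g2s_frame_def by (metis frame_coframe)

lemma g43_eq: "g43 A \<phi> p u v = g0 (coframe p u) (coframe p v)"
  by (simp add: g43_def frame_def coframe_def Let_def)

text \<open>The model cross product represents \<open>\<phi>\<close>; uniqueness behind the
  \<open>THE\<close> is nondegeneracy of \<open>g0\<close>.\<close>

lemma cross_eq:
  assumes "u \<in> tangent_space A p" "v \<in> tangent_space A p"
  shows "cross A \<phi> p u v = frame p (cross0 (coframe p u) (coframe p v))"
  unfolding cross_def
proof (rule the_equality)
  show "frame p (cross0 (coframe p u) (coframe p v)) \<in> tangent_space A p \<and>
    (\<forall>z\<in>tangent_space A p. \<phi> p u v z = g43 A \<phi> p (frame p (cross0 (coframe p u) (coframe p v))) z)"
    by (simp add: three_form_eq assms g43_eq phi0_eq_g0_cross0)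
next
  fix w assume w: "w \<in> tangent_space A p \<and> (\<forall>z\<in>tangent_space A p. \<phi> p u v z = g43 A \<phi> p w z)"
  define d where "d = coframe p w - cross0 (coframe p u) (coframe p v)"
  \<comment> \<open>Testing against \<open>flip0 d\<close> turns the \<open>g0\<close>-pairing with
    \<open>d\<close> into the Euclidean square of \<open>flip0 d\<close>.\<close>
  have "\<phi> p u v (frame p (flip0 d)) = g43 A \<phi> p w (frame p (flip0 d))" using w by simp
  then have "flip0 (cross0 (coframe p u) (coframe p v)) \<bullet> flip0 d = flip0 (coframe p w) \<bullet> flip0 d"
    by (simp add: three_form_eq assms g43_eq phi0_eq_g0_cross0 g0_eq_inner)
  moreover have "flip0 d = flip0 (coframe p w) - flip0 (cross0 (coframe p u) (coframe p v))"
    by (simp add: d_def linear_diff[OF linear_flip0])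
  ultimately have "flip0 d \<bullet> flip0 d = 0"
    by (metis inner_diff_left right_minus_eq)
  then have "flip0 d = 0" by simp
  then have "d = 0" by (metis flip0_flip0 linear_0[OF linear_flip0])
  then show "w = frame p (cross0 (coframe p u) (coframe p v))"
    using w by (simp add: d_def) (metis frame_coframe)
qed

lemma para_endo_eq:
  assumes "\<xi> p \<in> tangent_space A p" "u \<in> tangent_space A p"
  shows "para_endo A \<phi> \<xi> p u = frame p (cross0 (coframe p (\<xi> p)) (coframe p u))"
  by (simp add: para_endo_def cross_eq assms)

text \<open>The paracontact identity for the square of the endomorphism, where
  \<open>para_eta\<close> is minus the \<open>g43\<close>-pairing with \<open>\<xi>\<close>. It
  leaves a single scalar coefficient whose smoothness is in question.\<close>

lemma para_endo_para_endo:
  assumes "\<xi> p \<in> tangent_space A p" "u \<in> tangent_space A p" "g43 A \<phi> p (\<xi> p) (\<xi> p) = - 1"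
  shows "para_endo A \<phi> \<xi> p (para_endo A \<phi> \<xi> p u)
    = tv_add u (tv_scale (g43 A \<phi> p (\<xi> p) u) (\<xi> p))"
  using assms
  by (simp add: para_endo_eq cross0_cross0 g43_eq[symmetric] add.commute frame_add frame_scale)

lemma fundamental_2form_eq:
  assumes "\<xi> p \<in> tangent_space A p" "u \<in> tangent_space A p" "v \<in> tangent_space A p"
  shows "fundamental_2form A \<phi> \<xi> p u v = - \<phi> p (\<xi> p) u v"
  by (simp add: fundamental_2form_def para_metric_def para_endo_eq three_form_eq g43_eq assms
      phi0_eq_g0_cross0)

section \<open>Coordinate expressions in a chart\<close>

lemma chart_image:
  assumes "c \<in> A"
  shows "open (coord c ` dom_of c)" "x \<in> coord c ` dom_of c \<Longrightarrow> param c x \<in> dom_of c"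
proof -
  have "homeomorphism (dom_of c) (coord c ` dom_of c) (coord c) (param c)"
    and "open (coord c ` dom_of c)"
    using atlas assms by (auto simp: smooth_atlas_def is_chart_def)
  then show "open (coord c ` dom_of c)" "x \<in> coord c ` dom_of c \<Longrightarrow> param c x \<in> dom_of c"
    by (auto simp: homeomorphism_def)
qed

text \<open>\<open>Q\<close> reads the frame in the chart \<open>c\<close>, and \<open>B\<close>
  converts chart coordinates to model coordinates. \<open>Q\<close> is injective because a tangent
  vector that vanishes in one chart vanishes in all, the transition derivatives being
  linear.\<close>

lemma frame_matrix:
  assumes "c \<in> A" "p \<in> dom_of c"
  obtains B Q :: "real ^ 7 ^ 7"
  where "B ** Q = mat 1" "\<And>u. u \<in> tangent_space A p \<Longrightarrow> B *v u c = coframe p u"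
    "\<And>a. frame p (B *v a) c = a"
proof -
  define Q where "Q = matrix (\<lambda>x. frame p x c)"
  have Q: "Q *v x = frame p x c" for x
    unfolding Q_def by (rule matrix_works[OF linear_frame[folded linear_matrix_vector_mul_eq]])
  have "x = 0" if "Q *v x = 0" for x
  proof -
    have "frame p x d = 0" for d
    proof (cases "d \<in> A \<and> p \<in> dom_of d")
      case True
      then have "frame p x d = transition_deriv c d p (frame p x c)"
        using frame_mem[of p x] assms unfolding tangent_space_def by blast
      also have "\<dots> = 0"
        using linear_transition_deriv[OF atlas] True assms that Q by (simp add: linear_0)
      finally show ?thesis .
    next
      case False
      then show ?thesis using frame_mem[of p x] unfolding tangent_space_def by blast
    qed
    then have "frame p x = frame p 0" by (simp add: frame_0 tv_zero_def fun_eq_iff)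
    then show ?thesis by (metis coframe_frame)
  qed
  then obtain B where BQ: "B ** Q = mat 1"
    by (metis matrix_left_invertible_ker)
  then have QB: "Q ** B = mat 1" by (rule matrix_left_right_inverse[THEN iffD1])
  show thesis
  proof (rule that[OF BQ])
    show "B *v u c = coframe p u" if "u \<in> tangent_space A p" for u
      using Q[of "coframe p u"] that BQ by (metis frame_coframe matrix_vector_mul_assoc matrix_vector_mul_lid)
    show "frame p (B *v a) c = a" for a
      using Q[of "B *v a"] QB by (simp add: matrix_vector_mul_assoc)
  qed
qed

text \<open>The frame supplies a tangent vector \<open>u\<close> with coordinates \<open>a\<close>
  in \<open>c\<close>; its transformation law identifies it with
  \<open>coord_tv A c p a\<close>.\<close>

lemma coord_tv:
  assumes "c \<in> A" "p \<in> dom_of c"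
  shows "coord_tv A c p a \<in> tangent_space A p" "coord_tv A c p a c = a"
proof -
  obtain B Q where "B ** Q = mat 1" "\<And>a. frame p (B *v a) c = a"
    using frame_matrix[OF assms] by metis
  then obtain u where u: "u \<in> tangent_space A p" "u c = a" by (metis frame_mem)
  have "coord_tv A c p a d = u d" for d
  proof (cases "d \<in> A \<and> p \<in> dom_of d")
    case True
    then have "u d = transition_deriv c d p (u c)"
      using u(1) assms unfolding tangent_space_def by blast
    then show ?thesis using True u(2) by (simp add: coord_tv_def)
  next
    case False
    then have "u d = 0" using u(1) unfolding tangent_space_def by blast
    with False show ?thesis by (auto simp: coord_tv_def)
  qed
  then have "coord_tv A c p a = u" by blast
  then show "coord_tv A c p a \<in> tangent_space A p" "coord_tv A c p a c = a"
    using u by simp_all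
qed

text \<open>The form at \<open>param c x\<close> on coordinate vectors, written through the
  components that \<open>smooth_3form\<close> declares smooth.\<close>

definition local_form :: "('m, 7) chart \<Rightarrow> real ^ 7 \<Rightarrow> real ^ 7 \<Rightarrow> real ^ 7 \<Rightarrow> real ^ 7 \<Rightarrow> real" where
  "local_form c x u v w = (\<Sum>i\<in>UNIV. \<Sum>j\<in>UNIV. \<Sum>k\<in>UNIV. u $ i * v $ j * w $ k *
     \<phi> (param c x) (coord_tv A c (param c x) (axis i 1)) (coord_tv A c (param c x) (axis j 1))
       (coord_tv A c (param c x) (axis k 1)))"

lemma smooth_on_local_form:
  assumes "c \<in> A" "smooth_on (coord c ` dom_of c) u" "smooth_on (coord c ` dom_of c) v"
    "smooth_on (coord c ` dom_of c) w"
  shows "smooth_on (coord c ` dom_of c) (\<lambda>x. local_form c x (u x) (v x) (w x))"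
proof -
  have "smooth_3form A \<phi>" using g2s by (simp add: g2s_structure_def)
  then have form: "smooth_on (coord c ` dom_of c)
        (\<lambda>x. \<phi> (param c x) (coord_tv A c (param c x) (axis i 1))
               (coord_tv A c (param c x) (axis j 1)) (coord_tv A c (param c x) (axis k 1)))" for i j k
    using assms(1) unfolding smooth_3form_def by blast
  show ?thesis
    unfolding local_form_def
    by (intro smooth_on_sum smooth_on_mult smooth_on_nth chart_image(1) form assms)
qed

lemma local_form_eq:
  assumes "c \<in> A" "x \<in> coord c ` dom_of c"
    and "\<And>u. u \<in> tangent_space A (param c x) \<Longrightarrow> B *v u c = coframe (param c x) u"
  shows "local_form c x u v w = phi0 (B *v u) (B *v v) (B *v w)"
proof -
  have lin: "linear (\<lambda>u. f (B *v u))" if "linear f" for f :: "real ^ 7 \<Rightarrow> real"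
    using linear_compose[OF matrix_vector_mul_linear[of B] that] by (simp add: o_def)
  have "phi0 (B *v axis i 1) (B *v axis j 1) (B *v axis k 1) =
    \<phi> (param c x) (coord_tv A c (param c x) (axis i 1)) (coord_tv A c (param c x) (axis j 1))
       (coord_tv A c (param c x) (axis k 1))" for i j k
    using assms(1) chart_image(2)[OF assms(1,2)] by (simp add: three_form_eq coord_tv flip: assms(3))
  moreover have "phi0 (B *v u) (B *v v) (B *v w) = (\<Sum>i\<in>UNIV. \<Sum>j\<in>UNIV. \<Sum>k\<in>UNIV.
      u $ i * v $ j * w $ k * phi0 (B *v axis i 1) (B *v axis j 1) (B *v axis k 1))"
    by (rule trilinear_expand[where f = "\<lambda>u v w. phi0 (B *v u) (B *v v) (B *v w)"])
      (rule lin[OF linear_phi0_1] lin[OF linear_phi0_2] lin[OF linear_phi0_3])+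
  ultimately show ?thesis by (simp add: local_form_def)
qed

section \<open>Smoothness along vector fields\<close>

lemma smooth_vfieldD:
  assumes "smooth_vfield A X"
  shows "X p \<in> tangent_space A p"
    and "c \<in> A \<Longrightarrow> smooth_on (coord c ` dom_of c) (\<lambda>x. X (param c x) c)"
  using assms by (auto simp: smooth_vfield_def)

lemma smooth_on_three_form:
  assumes "c \<in> A" "smooth_vfield A X" "smooth_vfield A Y" "smooth_vfield A Z"
  shows "smooth_on (coord c ` dom_of c) ((\<lambda>q. \<phi> q (X q) (Y q) (Z q)) \<circ> param c)"
proof (rule smooth_on_cong)
  show "smooth_on (coord c ` dom_of c)
      (\<lambda>x. local_form c x (X (param c x) c) (Y (param c x) c) (Z (param c x) c))"
    using assms by (intro smooth_on_local_form smooth_vfieldD)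
next
  fix x assume x: "x \<in> coord c ` dom_of c"
  obtain B where B: "\<And>u. u \<in> tangent_space A (param c x) \<Longrightarrow> B *v u c = coframe (param c x) u"
    using frame_matrix[OF assms(1) chart_image(2)[OF assms(1) x]] by metis
  show "local_form c x (X (param c x) c) (Y (param c x) c) (Z (param c x) c)
      = ((\<lambda>q. \<phi> q (X q) (Y q) (Z q)) \<circ> param c) x"
    using local_form_eq[OF assms(1) x B] by (simp add: B three_form_eq smooth_vfieldD assms)
qed (use chart_image assms in auto)

text \<open>The trace formula is solved for the metric value. The frame matrix \<open>B\<close>
  serves only to establish the formula at each point; the resulting expression involves just
  \<open>local_form\<close>, the fields and the inverse of \<open>N\<close>.\<close>

lemma smooth_on_g43:
  assumes c: "c \<in> A" and X: "smooth_vfield A \<xi>" and Y: "smooth_vfield A Y"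
    and q: "\<And>p. g43 A \<phi> p (\<xi> p) (\<xi> p) = - 1"
  shows "smooth_on (coord c ` dom_of c) (\<lambda>x. g43 A \<phi> (param c x) (\<xi> (param c x)) (Y (param c x)))"
proof -
  let ?U = "coord c ` dom_of c"
  define \<xi>c where "\<xi>c x = \<xi> (param c x) c" for x
  define Yc where "Yc x = Y (param c x) c" for x
  \<comment> \<open>The Euclidean dual of \<open>\<xi>\<close> in the chart: a covector taking the
    value 1 on \<open>\<xi>\<close> and depending smoothly on the point.\<close>
  define a where "a x = (1 / (\<xi>c x \<bullet> \<xi>c x)) *\<^sub>R \<xi>c x" for x
  define N where "N x = form_matrix (\<lambda>u v. local_form c x (\<xi>c x) u v + (a x \<bullet> u) * (a x \<bullet> v))" for x
  note U = chart_image(1)[OF c]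
  have ex: "\<xi>c x \<noteq> 0 \<and> (\<exists>R. N x ** R = mat 1 \<and> trace (R ** form_matrix (local_form c x (Yc x)))
      = 2 * (a x \<bullet> Yc x) - 4 * g43 A \<phi> (param c x) (\<xi> (param c x)) (Y (param c x)))"
    if x: "x \<in> ?U" for x
  proof -
    obtain B Q where BQ: "B ** Q = mat 1"
      and B: "\<And>u. u \<in> tangent_space A (param c x) \<Longrightarrow> B *v u c = coframe (param c x) u"
      using frame_matrix[OF c chart_image(2)[OF c x]] by metis
    have cf: "coframe (param c x) (\<xi> (param c x)) = B *v \<xi>c x"
      "coframe (param c x) (Y (param c x)) = B *v Yc x"
      using B smooth_vfieldD(1)[OF X] smooth_vfieldD(1)[OF Y] by (auto simp: \<xi>c_def Yc_def)
    have q': "g0 (B *v \<xi>c x) (B *v \<xi>c x) = - 1"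
      using q[of "param c x"] by (simp add: g43_eq cf)
    then have nz: "\<xi>c x \<noteq> 0"
      by (auto simp: g0_def)
    then have ax: "a x \<bullet> \<xi>c x = 1"
      by (simp add: a_def)
    have lf: "local_form c x = (\<lambda>u v w. phi0 (B *v u) (B *v v) (B *v w))"
      using local_form_eq[OF c x B] by blast
    show ?thesis
      using nz trace_formula[OF BQ q' ax] unfolding N_def lf g43_eq cf by blast
  qed
  then obtain R where R: "\<And>x. x \<in> ?U \<Longrightarrow> N x ** R x = mat 1"
    "\<And>x. x \<in> ?U \<Longrightarrow> trace (R x ** form_matrix (local_form c x (Yc x)))
      = 2 * (a x \<bullet> Yc x) - 4 * g43 A \<phi> (param c x) (\<xi> (param c x)) (Y (param c x))"
    by metis
  have s\<xi>: "smooth_on ?U \<xi>c" and sY: "smooth_on ?U Yc"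
    unfolding \<xi>c_def Yc_def using X Y c by (auto intro: smooth_vfieldD)
  have sa: "smooth_on ?U a"
    unfolding a_def by (intro smooth_on_scaleR smooth_on_divide smooth_on_inner smooth_on_const U s\<xi>)
      (use ex in auto)
  have "smooth_on ?U (\<lambda>x. N x $ i $ j)" for i j
    unfolding N_def form_matrix_def vec_lambda_beta
    by (intro smooth_on_add smooth_on_mult smooth_on_inner smooth_on_local_form smooth_on_const U s\<xi> sa c)
  then have sR: "smooth_on ?U (\<lambda>x. R x $ i $ j)" for i j
    using R(1) by (rule smooth_on_right_inverse[OF U])
  show ?thesis
  proof (rule smooth_on_cong[OF U])
    \<comment> \<open>The trace is written out in entries; the order of \<open>i\<close> and
      \<open>k\<close> follows the column convention of \<open>form_matrix\<close>.\<close>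
    show "smooth_on ?U (\<lambda>x. (1 / 2) * (a x \<bullet> Yc x) - (1 / 4) *
        (\<Sum>i\<in>UNIV. \<Sum>k\<in>UNIV. R x $ i $ k * local_form c x (Yc x) (axis i 1) (axis k 1)))"
      by (intro smooth_on_diff smooth_on_sum smooth_on_mult smooth_on_inner smooth_on_local_form
          smooth_on_const U sY sa sR c)
  next
    fix x assume "x \<in> ?U"
    from R(2)[OF this] show "(1 / 2) * (a x \<bullet> Yc x) - (1 / 4) *
        (\<Sum>i\<in>UNIV. \<Sum>k\<in>UNIV. R x $ i $ k * local_form c x (Yc x) (axis i 1) (axis k 1))
      = g43 A \<phi> (param c x) (\<xi> (param c x)) (Y (param c x))"
      by (simp add: trace_def matrix_matrix_mult_def form_matrix_def field_simps)
  qed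
qed

lemma smooth_vfield_para_endo_para_endo:
  assumes X: "smooth_vfield A \<xi>" and Y: "smooth_vfield A Y"
    and q: "\<And>p. g43 A \<phi> p (\<xi> p) (\<xi> p) = - 1"
  shows "smooth_vfield A (\<lambda>q. para_endo A \<phi> \<xi> q (para_endo A \<phi> \<xi> q (Y q)))"
  unfolding smooth_vfield_def
proof (intro conjI allI ballI)
  show "para_endo A \<phi> \<xi> p (para_endo A \<phi> \<xi> p (Y p)) \<in> tangent_space A p" for p
    by (simp add: para_endo_eq smooth_vfieldD[OF X] smooth_vfieldD[OF Y])
next
  fix c assume c: "c \<in> A"
  have "smooth_on (coord c ` dom_of c) (\<lambda>x. Y (param c x) c +
      g43 A \<phi> (param c x) (\<xi> (param c x)) (Y (param c x)) *\<^sub>R \<xi> (param c x) c)"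
    by (intro smooth_on_add smooth_on_scaleR smooth_on_g43 chart_image(1) smooth_vfieldD(2) c assms)
  then show "smooth_on (coord c ` dom_of c)
      (\<lambda>x. para_endo A \<phi> \<xi> (param c x) (para_endo A \<phi> \<xi> (param c x) (Y (param c x))) c)"
    by (simp add: para_endo_para_endo q smooth_vfieldD[OF X] smooth_vfieldD[OF Y] tv_add_def tv_scale_def)
qed

section \<open>Comparison of the covariant derivatives\<close>

lemma dir_deriv_minus_three_form:
  assumes "smooth_vfield A X" "smooth_vfield A Y" "smooth_vfield A Z"
  shows "dir_deriv A W (\<lambda>q. - \<phi> q (X q) (Y q) (Z q)) p
    = - dir_deriv A W (\<lambda>q. \<phi> q (X q) (Y q) (Z q)) p"
proof -
  define c where "c = (SOME c. c \<in> A \<and> p \<in> dom_of c)"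
  have "\<exists>c. c \<in> A \<and> p \<in> dom_of c"
    using atlas unfolding smooth_atlas_def by blast
  from someI_ex[OF this] have c: "c \<in> A" "p \<in> dom_of c"
    unfolding c_def by simp_all
  define f where "f = (\<lambda>q. \<phi> q (X q) (Y q) (Z q)) \<circ> param c"
  have "f differentiable (at (coord c p))"
    unfolding f_def
    using smooth_on_three_form[OF c(1) assms] chart_image(1)[OF c(1)] c(2)
    by (intro smooth_on_differentiable) auto
  \<comment> \<open>Differentiability makes \<open>frechet_derivative\<close> a genuine derivative,
    so the sign can be pulled out of it.\<close>
  then have "(f has_derivative frechet_derivative f (at (coord c p))) (at (coord c p))"
    by (rule frechet_derivative_works[THEN iffD1])
  from frechet_derivative_at[OF has_derivative_minus[OF this]]
  have "frechet_derivative (\<lambda>x. - f x) (at (coord c p)) v = - frechet_derivative f (at (coord c p)) v" for v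
    by (rule fun_cong[THEN sym])
  moreover have "(\<lambda>q. - \<phi> q (X q) (Y q) (Z q)) \<circ> param c = (\<lambda>x. - f x)"
    by (simp add: f_def fun_eq_iff)
  ultimately show ?thesis
    unfolding dir_deriv_def Let_def c_def[symmetric] by (simp add: f_def)
qed

text \<open>By \<open>fundamental_2form_eq\<close> the two Leibniz expansions agree up to sign
  except for the term containing \<open>nabla X \<xi>\<close>, which vanishes by
  \<open>par\<close>.\<close>

lemma tensor_F_eq:
  assumes nabla: "affine_connection A nabla"
    and X: "smooth_vfield A \<xi>" "smooth_vfield A X" "smooth_vfield A Y" "smooth_vfield A Z"
    and par: "nabla X \<xi> p = tv_zero"
  shows "tensor_F A \<phi> \<xi> nabla X Y Z p = - cov_deriv3 A nabla \<phi> X \<xi> Y Z p"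
proof -
  have T: "\<xi> q \<in> tangent_space A q" "Y q \<in> tangent_space A q" "Z q \<in> tangent_space A q" for q
    using X by (auto simp: smooth_vfieldD)
  have "smooth_vfield A (nabla X Y)" "smooth_vfield A (nabla X Z)"
    using nabla X by (auto simp: affine_connection_def)
  then have T': "nabla X Y p \<in> tangent_space A p" "nabla X Z p \<in> tangent_space A p"
    by (auto simp: smooth_vfieldD)
  \<comment> \<open>The zero vector is written as \<open>frame p 0\<close> to exhibit it as tangent,
    so that \<open>three_form_eq\<close> applies.\<close>
  have "\<phi> p (nabla X \<xi> p) (Y p) (Z p) = 0"
    unfolding par frame_0[symmetric, of p]
    by (simp add: T three_form_eq linear_0[OF linear_phi0_1])
  then show ?thesis
    by (simp add: tensor_F_def cov_deriv2_def cov_deriv3_def fundamental_2form_eq T T'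
        dir_deriv_minus_three_form X)
qed

end

theorem theorem2:
  fixes A :: "('m::{t2_space, second_countable_topology}, 7) chart set"
    and \<phi> :: "('m, 7) three_tensor"
    and \<xi> :: "('m, 7) vfield"
    and nabla :: "('m, 7) conn"
  assumes "oriented_smooth_atlas A"
    and "g2s_structure A \<phi>"
    and "smooth_vfield A \<xi>"
    and "\<And>p. g43 A \<phi> p (\<xi> p) (\<xi> p) = -1"
    and "levi_civita A (para_metric A \<phi>) nabla"
    and "\<And>Y Z p. smooth_vfield A Y \<Longrightarrow> smooth_vfield A Z \<Longrightarrow> cov_deriv3 A nabla \<phi> \<xi> \<xi> Y Z p = 0"
    and "\<And>p. nabla \<xi> \<xi> p = tv_zero"
  shows "\<forall>X Y Z p. smooth_vfield A X \<longrightarrow> smooth_vfield A Y \<longrightarrow> smooth_vfield A Z \<longrightarrow>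
           F11 A \<phi> \<xi> nabla X Y Z p = 0"
proof -
  interpret g2s_manifold A \<phi>
    using assms(1,2) by unfold_locales (auto simp: oriented_smooth_atlas_def)
  have "affine_connection A nabla"
    using assms(5) by (simp add: levi_civita_def)
  \<comment> \<open>The squared endomorphism preserves smooth fields, so \<open>tensor_F_eq\<close>
    and the hypothesis on \<open>cov_deriv3\<close> apply to the two fields inside
    \<open>F11\<close>.\<close>
  then show ?thesis
    using assms(3,4,6,7)
    by (simp add: F11_def tensor_F_eq smooth_vfield_para_endo_para_endo)
qed

end
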